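(* Let $\mathscr{L}_1\big(m_1,\boldsymbol{u}_1,b_{1,i},b_{2,i},\xi_j,\nabla\xi_j,\mathrm{D}_t^1\xi_j\big)$ and $\mathscr{L}_2\big(m_2,\boldsymbol{u}_2,b_{2,i},b_{1,i},\xi_j,\nabla\xi_j,\mathrm{D}_t^2\xi_j\big)$ be smooth functions of their arguments, and let $m_k,\boldsymbol{u}_k,b_{k,i},\xi_j$ be a smooth solution of the generic system written in the context. For $k=1,2$ define the partial Hamiltonian $$\mathcal{H}_k=\boldsymbol{K}_k^\top\boldsymbol{u}_k+\sum_{j=1}^m\mathscr{M}_{k,j}\mathrm{D}_t^k\xi_j-\mathscr{L}_k .$$ Then the generic system admits a supplementary conservation law satisfied by the Hamiltonian $\mathcal{H}=\mathcal{H}_1+\mathcal{H}_2$, namely $$\partial_t\mathcal{H}+\nabla\cdot\Big(\mathcal{H}_1\boldsymbol{u}_1+\mathcal{H}_2\boldsymbol{u}_2+\boldsymbol{\Pi}_1^\top\boldsymbol{u}_1+\boldsymbol{\Pi}_2^\top\boldsymbol{u}_2+\sum_{j=1}^m\big(\boldsymbol{D}_{1,j}\mathrm{D}_t^1\xi_j+\boldsymbol{D}_{2,j}\mathrm{D}_t^2\xi_j\big)\Big)=0 .$$ Moreover, for $k=1,2$ and $k'=3-k$, the equation for the partial Hamiltonian $\mathcal{H}_k$ is $$\partial_t\mathcal{H}_k+\nabla\cdot\Big(\mathcal{H}_k\boldsymbol{u}_k+\boldsymbol{\Pi}_k^\top\boldsymbol{u}_k+\sum_{j=1}^m\boldsymbol{D}_{k,j}\mathrm{D}_t^k\xi_j\Big)=\sum_{i=1}^{n_k}\frac{\partial\mathscr{L}_{k'}}{\partial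 b_{k,i}}\partial_t b_{k,i}-\sum_{i=1}^{n_{k'}}\frac{\partial\mathscr{L}_k}{\partial b_{k',i}}\partial_t b_{k',i}+\sum_{j=1}^m\Big[\partial_t\mathscr{M}_{k,j}+\nabla\cdot(\mathscr{M}_{k,j}\boldsymbol{u}_k)+\nabla\cdot\boldsymbol{D}_{k,j}-\frac{\partial\mathscr{L}_k}{\partial\xi_j}\Big]\partial_t\xi_j .$$
   Context: The fields are defined on a space-time domain with $\boldsymbol{x}\in\mathbb{R}^d$. The $m_k$, $b_{k,i}$ ($k=1,2$, $i=1,\dots,n_k$) and $\xi_j$ ($j=1,\dots,m$) are scalar fields (with $m_k$ the partial masses), and $\boldsymbol{u}_k$ is an $\mathbb{R}^d$-valued velocity field. Notation $b_{k,i}$ (resp. $\xi_j$) as an argument of $\mathscr{L}_1,\mathscr{L}_2$ stands for dependence on all $i=1,\dots,n_k$ (resp. all $j$). Material derivative: $\mathrm{D}_t^k\bullet=\partial_t\bullet+(\boldsymbol{u}_k\cdot\nabla)\bullet$. Partial derivatives of $\mathscr{L}_k$ are taken with respect to the indicated argument slot, all other slots held fixed, and evaluated along the fields. Set $$\boldsymbol{K}_k=\Big(\frac{\partial\mathscr{L}_k}{\partial\boldsymbol{u}_k}\Big)^\top,\quad \mathscr{M}_{k,j}=\frac{\partial\mathscr{L}_k}{\partial(\mathrm{D}_t^k\xi_j)},\quad \boldsymbol{D}_{k,j}=\Big(\frac{\partial\mathscr{L}_k}{\partial(\nabla\xi_j)}\Big)^\top,\quad \boldsymbol{\Pi}_k=\Big(\mathscr{L}_k-m_k\frac{\partial\mathscr{L}_k}{\partial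 m_k}\Big)\mathbf{I}_d-\sum_{j=1}^m\nabla\xi_j\otimes\boldsymbol{D}_{k,j}.$$ The generic system consists of the constraints, for $k=1,2$, $$\partial_t m_k+\nabla\cdot(m_k\boldsymbol{u}_k)=0,\qquad \mathrm{D}_t^k b_{k,i}=0\quad(i=1,\dots,n_k),$$ together with the equations, for $k=1,2$ and $k'=3-k$, $$\partial_t\boldsymbol{K}_k+\nabla\cdot(\boldsymbol{K}_k\otimes\boldsymbol{u}_k+\boldsymbol{\Pi}_k)=-\sum_{j=1}^m\Big[\partial_t\mathscr{M}_{k,j}+\nabla\cdot(\mathscr{M}_{k,j}\boldsymbol{u}_k)+\nabla\cdot\boldsymbol{D}_{k,j}-\frac{\partial\mathscr{L}_k}{\partial\xi_j}\Big]\nabla\xi_j+\sum_{i=1}^{n_{k'}}\frac{\partial\mathscr{L}_k}{\partial b_{k',i}}\nabla b_{k',i}-\sum_{i=1}^{n_k}\frac{\partial\mathscr{L}_{k'}}{\partial b_{k,i}}\nabla b_{k,i},$$ and, for $j=1,\dots,m$, $$\partial_t(\mathscr{M}_{1,j}+\mathscr{M}_{2,j})+\nabla\cdot\big(\mathscr{M}_{1,j}\boldsymbol{u}_1+\mathscr{M}_{2,j}\boldsymbol{u}_2+\boldsymbol{D}_{1,j}+\boldsymbol{D}_{2,j}\big)-\frac{\partial\mathscr{L}_1}{\partial\xi_j}-\frac{\partial\mathscr{L}_2}{\partial\xi_j}=0.$$ Conventions: vectors are columns; the derivative of a scalar with respect to a vector is a row vector, and the gradient of a scalar field is a column vector; the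 gradient of a vector field is the transpose of its Jacobian matrix; the divergence of a matrix field is the column vector obtained by taking the divergence of each row; $\boldsymbol{a}\otimes\boldsymbol{b}=\boldsymbol{a}\boldsymbol{b}^\top$; $\mathbf{I}_d$ is the identity matrix. *)

theory Defs
  imports "HOL-Analysis.Analysis"
begin

text \<open>
  A field is a function on space-time points \<open>z = (t, x)\<close>.  The families indexed by
  \<open>i = 1, \<dots>, n\<^sub>k\<close> and \<open>j = 1, \<dots>, m\<close> are indexed by finite types.  An empty family is
  represented by a one-element index type, the field being identically zero and the Lagrangians not
  depending on the corresponding slots: the constraints and equations for that dummy component then
  hold trivially, and all its contributions to the sums vanish.
\<close>

type_synonym 'd spacetime = "real \<times> (real^'d)"

primrec C_k_on :: "nat \<Rightarrow> 'a::euclidean_space set \<Rightarrow> ('a \<Rightarrow> 'b::real_normed_vector) \<Rightarrow> bool" where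
  "C_k_on 0 S f \<longleftrightarrow> continuous_on S f"
| "C_k_on (Suc k) S f \<longleftrightarrow>
     (\<forall>x\<in>S. f differentiable (at x)) \<and> (\<forall>v. C_k_on k S (\<lambda>x. frechet_derivative f (at x) v))"

definition smooth_on :: "'a::euclidean_space set \<Rightarrow> ('a \<Rightarrow> 'b::real_normed_vector) \<Rightarrow> bool" where
  "smooth_on S f \<longleftrightarrow> (\<forall>k. C_k_on k S f)"

text \<open>The partial derivative of \<open>f\<close> at \<open>z\<close> in the coordinate direction \<open>e\<close>.\<close>

definition partial :: "'a::euclidean_space \<Rightarrow> ('a \<Rightarrow> 'b::real_normed_vector) \<Rightarrow> 'a \<Rightarrow> 'b" where
  "partial e f z = vector_derivative (\<lambda>s. f (z + s *\<^sub>R e)) (at 0)"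

definition pt :: "('d::finite spacetime \<Rightarrow> 'b::real_normed_vector) \<Rightarrow> 'd spacetime \<Rightarrow> 'b" where
  "pt = partial (1, 0)"

definition px :: "'d::finite \<Rightarrow> ('d spacetime \<Rightarrow> 'b::real_normed_vector) \<Rightarrow> 'd spacetime \<Rightarrow> 'b" where
  "px i = partial (0, axis i 1)"

definition grad :: "('d::finite spacetime \<Rightarrow> real) \<Rightarrow> 'd spacetime \<Rightarrow> real^'d" where
  "grad f z = (\<chi> i. px i f z)"

definition diverg :: "('d::finite spacetime \<Rightarrow> real^'d) \<Rightarrow> 'd spacetime \<Rightarrow> real" where
  "diverg F z = (\<Sum>i\<in>UNIV. px i (\<lambda>y. F y $ i) z)"

text \<open>Matrices are indexed as \<open>A $ row $ column\<close>.\<close>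

definition diverg_mat :: "('d::finite spacetime \<Rightarrow> real^'d^'d) \<Rightarrow> 'd spacetime \<Rightarrow> real^'d" where
  "diverg_mat A z = (\<chi> r. diverg (\<lambda>y. A y $ r) z)"

definition outer :: "real^'n \<Rightarrow> real^'m \<Rightarrow> real^'m^'n"  (infixr \<open>\<otimes>\<^sub>v\<close> 75) where
  "a \<otimes>\<^sub>v b = (\<chi> r c. a $ r * b $ c)"

definition material :: "('d::finite spacetime \<Rightarrow> real^'d) \<Rightarrow> ('d spacetime \<Rightarrow> real) \<Rightarrow> 'd spacetime \<Rightarrow> real"
  where "material u f z = pt f z + u z \<bullet> grad f z"

text \<open>
  The argument \<open>(m\<^sub>k, u\<^sub>k, b\<^sub>k, b\<^sub>k\<^sub>', \<xi>, \<nabla>\<xi>, D\<^sub>t\<^sup>k \<xi>)\<close> of the Lagrangian of phase \<open>k\<close>, where \<open>k' = 3 - k\<close>: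
  the third slot holds the phase's own family \<open>b\<^sub>k\<close>, the fourth that of the other phase.  Row \<open>j\<close>
  of the sixth slot is \<open>\<nabla>\<xi>\<^sub>j\<close>.
\<close>

type_synonym ('d, 'n, 'o, 'm) args =
  "real \<times> (real^'d) \<times> (real^'n) \<times> (real^'o) \<times> (real^'m) \<times> (real^'d^'m) \<times> (real^'m)"

type_synonym ('d, 'n, 'o, 'm) lagrangian = "('d, 'n, 'o, 'm) args \<Rightarrow> real"

type_synonym ('d, 'n, 'o, 'm) state = "'d spacetime \<Rightarrow> ('d, 'n, 'o, 'm) args"

definition state ::
  "('d::finite spacetime \<Rightarrow> real) \<Rightarrow> ('d spacetime \<Rightarrow> real^'d) \<Rightarrow> ('n::finite \<Rightarrow> 'd spacetime \<Rightarrow> real) \<Rightarrow>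
   ('o::finite \<Rightarrow> 'd spacetime \<Rightarrow> real) \<Rightarrow> ('m::finite \<Rightarrow> 'd spacetime \<Rightarrow> real) \<Rightarrow> ('d, 'n, 'o, 'm) state"
  where "state m u b b' \<xi> z =
    (m z, u z, \<chi> i. b i z, \<chi> i. b' i z, \<chi> j. \<xi> j z, \<chi> j. grad (\<xi> j) z, \<chi> j. material u (\<xi> j) z)"

text \<open>Partial derivatives of a Lagrangian with respect to its slots.\<close>

definition d_mass :: "('d::finite, 'n::finite, 'o::finite, 'm::finite) lagrangian \<Rightarrow> ('d,'n,'o,'m) args \<Rightarrow> real"
  where "d_mass L = partial (1, 0, 0, 0, 0, 0, 0) L"

definition d_vel :: "('d::finite, 'n::finite, 'o::finite, 'm::finite) lagrangian \<Rightarrow> ('d,'n,'o,'m) args \<Rightarrow> real^'d"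
  where "d_vel L a = (\<chi> i. partial (0, axis i 1, 0, 0, 0, 0, 0) L a)"

definition d_other :: "('d::finite, 'n::finite, 'o::finite, 'm::finite) lagrangian \<Rightarrow> 'o \<Rightarrow> ('d,'n,'o,'m) args \<Rightarrow> real"
  where "d_other L i = partial (0, 0, 0, axis i 1, 0, 0, 0) L"

definition d_xi :: "('d::finite, 'n::finite, 'o::finite, 'm::finite) lagrangian \<Rightarrow> 'm \<Rightarrow> ('d,'n,'o,'m) args \<Rightarrow> real"
  where "d_xi L j = partial (0, 0, 0, 0, axis j 1, 0, 0) L"

definition d_grad_xi :: "('d::finite, 'n::finite, 'o::finite, 'm::finite) lagrangian \<Rightarrow> 'm \<Rightarrow> ('d,'n,'o,'m) args \<Rightarrow> real^'d"
  where "d_grad_xi L j a = (\<chi> i. partial (0, 0, 0, 0, 0, axis j (axis i 1), 0) L a)"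

definition d_Dt_xi :: "('d::finite, 'n::finite, 'o::finite, 'm::finite) lagrangian \<Rightarrow> 'm \<Rightarrow> ('d,'n,'o,'m) args \<Rightarrow> real"
  where "d_Dt_xi L j = partial (0, 0, 0, 0, 0, 0, axis j 1) L"

text \<open>The derived fields of one phase, with Lagrangian \<open>L\<close> evaluated along the state \<open>A\<close>.\<close>

definition K_field ::
  "('d::finite, 'n::finite, 'o::finite, 'm::finite) lagrangian \<Rightarrow> ('d,'n,'o,'m) state \<Rightarrow> 'd spacetime \<Rightarrow> real^'d"
  where "K_field L A z = d_vel L (A z)"

definition M_field ::
  "('d::finite, 'n::finite, 'o::finite, 'm::finite) lagrangian \<Rightarrow> ('d,'n,'o,'m) state \<Rightarrow> 'm \<Rightarrow> 'd spacetime \<Rightarrow> real"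
  where "M_field L A j z = d_Dt_xi L j (A z)"

definition D_field ::
  "('d::finite, 'n::finite, 'o::finite, 'm::finite) lagrangian \<Rightarrow> ('d,'n,'o,'m) state \<Rightarrow> 'm \<Rightarrow> 'd spacetime \<Rightarrow> real^'d"
  where "D_field L A j z = d_grad_xi L j (A z)"

definition Pi_field ::
  "('d::finite, 'n::finite, 'o::finite, 'm::finite) lagrangian \<Rightarrow> ('d,'n,'o,'m) state \<Rightarrow> ('d spacetime \<Rightarrow> real) \<Rightarrow>
   ('m \<Rightarrow> 'd spacetime \<Rightarrow> real) \<Rightarrow> 'd spacetime \<Rightarrow> real^'d^'d"
  where "Pi_field L A m \<xi> z =
    (L (A z) - m z * d_mass L (A z)) *\<^sub>R mat 1 - (\<Sum>j\<in>UNIV. grad (\<xi> j) z \<otimes>\<^sub>v D_field L A j z)"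

definition partial_hamiltonian ::
  "('d::finite, 'n::finite, 'o::finite, 'm::finite) lagrangian \<Rightarrow> ('d,'n,'o,'m) state \<Rightarrow>
   ('d spacetime \<Rightarrow> real^'d) \<Rightarrow> ('m \<Rightarrow> 'd spacetime \<Rightarrow> real) \<Rightarrow> 'd spacetime \<Rightarrow> real"
  where "partial_hamiltonian L A u \<xi> z =
    K_field L A z \<bullet> u z + (\<Sum>j\<in>UNIV. M_field L A j z * material u (\<xi> j) z) - L (A z)"

text \<open>The bracket multiplying \<open>\<nabla>\<xi>\<^sub>j\<close> in the momentum equation.\<close>

definition xi_bracket ::
  "('d::finite, 'n::finite, 'o::finite, 'm::finite) lagrangian \<Rightarrow> ('d,'n,'o,'m) state \<Rightarrow>
   ('d spacetime \<Rightarrow> real^'d) \<Rightarrow> 'm \<Rightarrow> 'd spacetime \<Rightarrow> real"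
  where "xi_bracket L A u j z =
    pt (M_field L A j) z + diverg (\<lambda>y. M_field L A j y *\<^sub>R u y) z + diverg (D_field L A j) z
    - d_xi L j (A z)"

definition phase_constraints ::
  "'d::finite spacetime set \<Rightarrow> ('d spacetime \<Rightarrow> real) \<Rightarrow> ('d spacetime \<Rightarrow> real^'d) \<Rightarrow>
   ('n::finite \<Rightarrow> 'd spacetime \<Rightarrow> real) \<Rightarrow> bool"
  where "phase_constraints \<Omega> m u b \<longleftrightarrow>
    (\<forall>z\<in>\<Omega>. pt m z + diverg (\<lambda>y. m y *\<^sub>R u y) z = 0) \<and> (\<forall>i. \<forall>z\<in>\<Omega>. material u (b i) z = 0)"

text \<open>Momentum equation of the phase with Lagrangian \<open>L\<close>, state \<open>A\<close>, fields \<open>m, u, b\<close>; the primed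
  quantities belong to the other phase.\<close>

definition momentum_equation ::
  "'d::finite spacetime set \<Rightarrow>
   ('d, 'n::finite, 'o::finite, 'm::finite) lagrangian \<Rightarrow> ('d, 'n, 'o, 'm) state \<Rightarrow>
   ('d, 'o, 'n, 'm) lagrangian \<Rightarrow> ('d, 'o, 'n, 'm) state \<Rightarrow>
   ('d spacetime \<Rightarrow> real) \<Rightarrow> ('d spacetime \<Rightarrow> real^'d) \<Rightarrow> ('n \<Rightarrow> 'd spacetime \<Rightarrow> real) \<Rightarrow>
   ('o \<Rightarrow> 'd spacetime \<Rightarrow> real) \<Rightarrow> ('m \<Rightarrow> 'd spacetime \<Rightarrow> real) \<Rightarrow> bool"
  where "momentum_equation \<Omega> L A L' A' m u b b' \<xi> \<longleftrightarrow>
    (\<forall>z\<in>\<Omega>. pt (K_field L A) z + diverg_mat (\<lambda>y. K_field L A y \<otimes>\<^sub>v u y + Pi_field L A m \<xi> y) z =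
      - (\<Sum>j\<in>UNIV. xi_bracket L A u j z *\<^sub>R grad (\<xi> j) z)
      + (\<Sum>i\<in>UNIV. d_other L i (A z) *\<^sub>R grad (b' i) z)
      - (\<Sum>i\<in>UNIV. d_other L' i (A' z) *\<^sub>R grad (b i) z))"

definition xi_equations ::
  "'d::finite spacetime set \<Rightarrow>
   ('d, 'n1::finite, 'n2::finite, 'm::finite) lagrangian \<Rightarrow> ('d, 'n1, 'n2, 'm) state \<Rightarrow>
   ('d, 'n2, 'n1, 'm) lagrangian \<Rightarrow> ('d, 'n2, 'n1, 'm) state \<Rightarrow>
   ('d spacetime \<Rightarrow> real^'d) \<Rightarrow> ('d spacetime \<Rightarrow> real^'d) \<Rightarrow> bool"
  where "xi_equations \<Omega> L1 A1 L2 A2 u1 u2 \<longleftrightarrow>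
    (\<forall>j. \<forall>z\<in>\<Omega>. pt (\<lambda>y. M_field L1 A1 j y + M_field L2 A2 j y) z
      + diverg (\<lambda>y. M_field L1 A1 j y *\<^sub>R u1 y + M_field L2 A2 j y *\<^sub>R u2 y
          + D_field L1 A1 j y + D_field L2 A2 j y) z
      - d_xi L1 j (A1 z) - d_xi L2 j (A2 z) = 0)"

definition generic_system ::
  "'d::finite spacetime set \<Rightarrow>
   ('d, 'n1::finite, 'n2::finite, 'm::finite) lagrangian \<Rightarrow> ('d, 'n2, 'n1, 'm) lagrangian \<Rightarrow>
   ('d spacetime \<Rightarrow> real) \<Rightarrow> ('d spacetime \<Rightarrow> real) \<Rightarrow>
   ('d spacetime \<Rightarrow> real^'d) \<Rightarrow> ('d spacetime \<Rightarrow> real^'d) \<Rightarrow>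
   ('n1 \<Rightarrow> 'd spacetime \<Rightarrow> real) \<Rightarrow> ('n2 \<Rightarrow> 'd spacetime \<Rightarrow> real) \<Rightarrow>
   ('m \<Rightarrow> 'd spacetime \<Rightarrow> real) \<Rightarrow> bool"
  where "generic_system \<Omega> L1 L2 m1 m2 u1 u2 b1 b2 \<xi> \<longleftrightarrow>
    (let A1 = state m1 u1 b1 b2 \<xi>; A2 = state m2 u2 b2 b1 \<xi> in
      phase_constraints \<Omega> m1 u1 b1 \<and> phase_constraints \<Omega> m2 u2 b2 \<and>
      momentum_equation \<Omega> L1 A1 L2 A2 m1 u1 b1 b2 \<xi> \<and>
      momentum_equation \<Omega> L2 A2 L1 A1 m2 u2 b2 b1 \<xi> \<and>
      xi_equations \<Omega> L1 A1 L2 A2 u1 u2)"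

end

theory Submission
  imports Defs
begin

text \<open>
  Contracting the momentum equation of phase \<open>k\<close> with \<open>u\<^sub>k\<close> and expanding \<open>D\<^sub>t\<^sup>k L\<^sub>k\<close> by the chain
  rule, the terms in \<open>D\<^sub>t\<^sup>k u\<^sub>k\<close> and \<open>D\<^sub>t\<^sup>k D\<^sub>t\<^sup>k \<xi>\<^sub>j\<close> disappear because \<open>H\<^sub>k\<close> is a Legendre transform, those
  in \<open>D\<^sub>t\<^sup>k m\<^sub>k\<close> and \<open>D\<^sub>t\<^sup>k b\<^sub>k\<^sub>,\<^sub>i\<close> are removed by the constraints, and the second derivatives of \<open>\<xi>\<^sub>j\<close>
  cancel by their symmetry; what remains is the equation for \<open>H\<^sub>k\<close>. Adding the two phases, the
  exchange terms in \<open>b\<close> are opposite, and those in \<open>\<xi>\<^sub>j\<close> add up to the equation for \<open>\<xi>\<^sub>j\<close>.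
\<close>

subsection \<open>Smooth functions and partial derivatives\<close>

text \<open>The chain rule along the line \<open>z + s e\<close>. It carries the rules for
  \<open>has_derivative\<close> over to \<open>partial\<close>, which is defined through one line
  only; the calculus rules below are instances of it.\<close>

lemma partial_eqI:
  assumes "(f has_derivative f') (at z)"
  shows "partial e f z = f' e"
proof -
  have "((\<lambda>s. z + s *\<^sub>R e) has_derivative (\<lambda>s. s *\<^sub>R e)) (at 0)"
    by (auto intro!: derivative_eq_intros)
  moreover have "(f has_derivative f') (at (z + 0 *\<^sub>R e))"
    using assms by simp
  ultimately have "((\<lambda>s. f (z + s *\<^sub>R e)) has_derivative (\<lambda>s. f' (s *\<^sub>R e))) (at 0)"
    by (rule has_derivative_compose)
  moreover have "f' (s *\<^sub>R e) = s *\<^sub>R f' e" for s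
    using assms by (simp add: has_derivative_def bounded_linear.linear linear_cmul)
  ultimately show ?thesis
    by (simp add: partial_def has_vector_derivative_def vector_derivative_at)
qed

lemma partial_eq_frechet_derivative:
  "f differentiable (at z) \<Longrightarrow> partial e f z = frechet_derivative f (at z) e"
  by (simp add: partial_eqI frechet_derivative_works[symmetric])

lemma has_derivative_partial:
  "f differentiable (at z) \<Longrightarrow> (f has_derivative (\<lambda>e. partial e f z)) (at z)"
  by (simp add: partial_eq_frechet_derivative frechet_derivative_works[symmetric])

lemma linear_partial:
  "f differentiable (at z) \<Longrightarrow> linear (\<lambda>e. partial e f z)"
  by (rule has_derivative_linear[OF has_derivative_partial])

text \<open>A derivative at \<open>x\<close> depends only on values near \<open>x\<close>, so
  agreement on an open set passes to derivatives of every order. This lets \<open>partial\<close>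
  replace \<open>frechet_derivative\<close> inside \<open>C_k_on\<close>, although the two are known
  to agree on \<open>S\<close> only.\<close>

lemma C_k_on_cong:
  assumes "open S" "\<And>x. x \<in> S \<Longrightarrow> f x = g x" "C_k_on k S f"
  shows "C_k_on k S g"
  using assms(2,3)
proof (induction k arbitrary: f g)
  case 0
  then show ?case by (simp cong: continuous_on_cong)
next
  case (Suc k)
  have d: "(g has_derivative frechet_derivative f (at x)) (at x)" if "x \<in> S" for x
  proof (rule has_derivative_transform_within_open[OF _ assms(1) that])
    show "(f has_derivative frechet_derivative f (at x)) (at x)"
      using Suc.prems that by (simp add: frechet_derivative_works[symmetric])
  qed (use Suc.prems in auto)
  then have "frechet_derivative g (at x) = frechet_derivative f (at x)" if "x \<in> S" for x
    using frechet_derivative_at[OF d[OF that]] by simp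
  then have "C_k_on k S (\<lambda>x. frechet_derivative g (at x) v)" for v
    using Suc.IH[of "\<lambda>x. frechet_derivative f (at x) v"] Suc.prems by auto
  with d show ?case by (auto simp: differentiable_def)
qed

lemma smooth_on_differentiable: "smooth_on S f \<Longrightarrow> x \<in> S \<Longrightarrow> f differentiable (at x)"
  unfolding smooth_on_def by (drule spec[of _ "Suc 0"]) simp

lemma smooth_on_continuous_on: "smooth_on S f \<Longrightarrow> continuous_on S f"
  unfolding smooth_on_def by (drule spec[of _ 0]) simp

lemma smooth_on_partial:
  assumes "open S" "smooth_on S f"
  shows "smooth_on S (partial e f)"
  unfolding smooth_on_def
proof
  fix k
  have "C_k_on k S (\<lambda>x. frechet_derivative f (at x) e)"
    using assms(2) unfolding smooth_on_def by (auto dest: spec[of _ "Suc k"])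
  then show "C_k_on k S (partial e f)"
    by (rule C_k_on_cong[OF assms(1), rotated])
      (simp add: partial_eq_frechet_derivative smooth_on_differentiable[OF assms(2)])
qed

text \<open>The mean value theorem is applied twice: along \<open>v\<close> to the increment of
  \<open>f\<close> over \<open>h w\<close>, then along \<open>w\<close> to
  \<open>partial v f\<close>. The second difference on the left is symmetric in \<open>v\<close> and
  \<open>w\<close>, which \<open>partial_commute\<close> exploits.\<close>

lemma double_mean_value:
  fixes f :: "'a::euclidean_space \<Rightarrow> real"
  assumes f: "\<And>s t. 0 \<le> s \<Longrightarrow> s \<le> h \<Longrightarrow> 0 \<le> t \<Longrightarrow> t \<le> h \<Longrightarrow>
      f differentiable (at (z + s *\<^sub>R v + t *\<^sub>R w))"
    and g: "\<And>s t. 0 \<le> s \<Longrightarrow> s \<le> h \<Longrightarrow> 0 \<le> t \<Longrightarrow> t \<le> h \<Longrightarrow>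
      partial v f differentiable (at (z + s *\<^sub>R v + t *\<^sub>R w))"
    and h: "0 < h"
  shows "\<exists>s t. 0 < s \<and> s < h \<and> 0 < t \<and> t < h \<and>
    f (z + h *\<^sub>R v + h *\<^sub>R w) - f (z + h *\<^sub>R v) - f (z + h *\<^sub>R w) + f z
      = h * h * partial w (partial v f) (z + s *\<^sub>R v + t *\<^sub>R w)"
proof -
  have along: "((\<lambda>s. k (a + s *\<^sub>R e)) has_real_derivative partial e k (a + s *\<^sub>R e)) (at s)"
    if "k differentiable (at (a + s *\<^sub>R e))" for k :: "'a \<Rightarrow> real" and a e s
  proof -
    have "((\<lambda>s. a + s *\<^sub>R e) has_derivative (\<lambda>s. s *\<^sub>R e)) (at s)"
      by (auto intro!: derivative_eq_intros)
    from has_derivative_compose[OF this has_derivative_partial[OF that]]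
    show ?thesis
      using linear_cmul[OF linear_partial[OF that]]
      by (simp add: has_field_derivative_def mult.commute[of _ "partial e k _"])
  qed
  define \<phi> where "\<phi> s = f (z + h *\<^sub>R w + s *\<^sub>R v) - f (z + s *\<^sub>R v)" for s
  have "(\<phi> has_real_derivative
      partial v f (z + h *\<^sub>R w + s *\<^sub>R v) - partial v f (z + s *\<^sub>R v)) (at s)"
    if "0 \<le> s" "s \<le> h" for s
    unfolding \<phi>_def using f[of s h] f[of s 0] that h
    by (intro DERIV_diff along) (auto simp: algebra_simps)
  from MVT2[OF h this] obtain s where s: "0 < s" "s < h" and
    1: "\<phi> h - \<phi> 0 = h * (partial v f (z + h *\<^sub>R w + s *\<^sub>R v) - partial v f (z + s *\<^sub>R v))"
    by auto
  have "((\<lambda>t. partial v f (z + s *\<^sub>R v + t *\<^sub>R w)) has_real_derivative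
      partial w (partial v f) (z + s *\<^sub>R v + t *\<^sub>R w)) (at t)"
    if "0 \<le> t" "t \<le> h" for t
    using g[of s t] that s by (intro along) auto
  from MVT2[OF h this] obtain t where t: "0 < t" "t < h" and
    2: "partial v f (z + s *\<^sub>R v + h *\<^sub>R w) - partial v f (z + s *\<^sub>R v)
      = h * partial w (partial v f) (z + s *\<^sub>R v + t *\<^sub>R w)"
    by auto
  have "f (z + h *\<^sub>R v + h *\<^sub>R w) - f (z + h *\<^sub>R v) - f (z + h *\<^sub>R w) + f z = \<phi> h - \<phi> 0"
    by (simp add: \<phi>_def algebra_simps)
  also have "\<dots> = h * h * partial w (partial v f) (z + s *\<^sub>R v + t *\<^sub>R w)"
    using 1 2 by (simp add: algebra_simps)
  finally show ?thesis using s t by blast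
qed

text \<open>One second difference over the parallelogram with sides \<open>h v\<close> and
  \<open>h w\<close> equals \<open>h * h\<close> times either mixed derivative, each taken at some
  point of the parallelogram. If the two differed at \<open>z\<close>, continuity would keep them
  apart on a small parallelogram.\<close>

lemma partial_commute:
  fixes f :: "'a::euclidean_space \<Rightarrow> real"
  assumes S: "open S" and f: "smooth_on S f" and z: "z \<in> S"
  shows "partial v (partial w f) z = partial w (partial v f) z"
proof (rule ccontr)
  assume neq: "\<not> ?thesis"
  \<comment> \<open>Half the gap: a value closer than this to one mixed derivative at
    \<open>z\<close> cannot equal a value that close to the other.\<close>
  define \<epsilon> where "\<epsilon> = \<bar>partial v (partial w f) z - partial w (partial v f) z\<bar> / 2"
  have \<epsilon>: "\<epsilon> > 0" using neq by (simp add: \<epsilon>_def)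
  have near: "\<exists>d>0. \<forall>y. dist y z < d \<longrightarrow> \<bar>partial a (partial b f) y - partial a (partial b f) z\<bar> < \<epsilon>"
    for a b
  proof -
    have "continuous_on S (partial a (partial b f))"
      using S f smooth_on_partial smooth_on_continuous_on by blast
    then have "isCont (partial a (partial b f)) z"
      using S z continuous_on_eq_continuous_at by blast
    then show ?thesis
      using \<epsilon> unfolding continuous_at_eps_delta dist_real_def by blast
  qed
  obtain d1 where d1: "d1 > 0"
    "\<And>y. dist y z < d1 \<Longrightarrow> \<bar>partial v (partial w f) y - partial v (partial w f) z\<bar> < \<epsilon>"
    using near by blast
  obtain d2 where d2: "d2 > 0"
    "\<And>y. dist y z < d2 \<Longrightarrow> \<bar>partial w (partial v f) y - partial w (partial v f) z\<bar> < \<epsilon>"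
    using near by blast
  obtain d3 where d3: "d3 > 0" "\<And>y. dist y z < d3 \<Longrightarrow> y \<in> S"
    using S z unfolding open_dist by blast
  define d where "d = min d1 (min d2 d3)"
  \<comment> \<open>Small enough for the whole parallelogram to stay within distance
    \<open>d\<close> of \<open>z\<close>; the summand 1 keeps the denominator positive even if both
    directions vanish.\<close>
  define h where "h = d / (2 * (norm v + norm w + 1))"
  have c: "norm v + norm w + 1 > 0" by (smt (verit) norm_ge_zero)
  have "d > 0" using d1 d2 d3 by (simp add: d_def)
  then have h: "h > 0" using c by (simp add: h_def)
  have small: "dist (z + s *\<^sub>R v + t *\<^sub>R w) z < d"
    if "0 \<le> s" "s \<le> h" "0 \<le> t" "t \<le> h" for s t
  proof -
    have "dist (z + s *\<^sub>R v + t *\<^sub>R w) z = norm (s *\<^sub>R v + t *\<^sub>R w)"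
      by (simp add: dist_norm add.assoc)
    also have "\<dots> \<le> s * norm v + t * norm w"
      using norm_triangle_ineq[of "s *\<^sub>R v" "t *\<^sub>R w"] that by simp
    also have "\<dots> \<le> h * norm v + h * norm w"
      using that by (intro add_mono mult_right_mono) auto
    also have "\<dots> < 2 * (h * (norm v + norm w + 1))"
      using h mult_nonneg_nonneg[of h "norm v"] mult_nonneg_nonneg[of h "norm w"]
      unfolding distrib_left by (smt (verit) norm_ge_zero)
    also have "\<dots> = d" using c unfolding h_def by (simp add: divide_simps)
    finally show ?thesis .
  qed
  have dS: "k differentiable (at (z + s *\<^sub>R v + t *\<^sub>R w))"
    if "smooth_on S k" "0 \<le> s" "s \<le> h" "0 \<le> t" "t \<le> h" for s t and k :: "'a \<Rightarrow> real"
    using small[OF that(2-5)] d3 that(1) smooth_on_differentiable by (auto simp: d_def)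
  obtain s t where st: "0 < s" "s < h" "0 < t" "t < h" and
    1: "f (z + h *\<^sub>R v + h *\<^sub>R w) - f (z + h *\<^sub>R v) - f (z + h *\<^sub>R w) + f z
      = h * h * partial w (partial v f) (z + s *\<^sub>R v + t *\<^sub>R w)"
    using double_mean_value[of h f z v w] dS f smooth_on_partial[OF S f] h by blast
  have swap: "z + a + b = z + b + a" for a b :: 'a by (simp add: add_ac)
  \<comment> \<open>The same second difference with the directions exchanged, so \<open>s'\<close>
    runs along \<open>w\<close> and \<open>t'\<close> along \<open>v\<close>.\<close>
  obtain s' t' where st': "0 < s'" "s' < h" "0 < t'" "t' < h" and
    2: "f (z + h *\<^sub>R w + h *\<^sub>R v) - f (z + h *\<^sub>R w) - f (z + h *\<^sub>R v) + f z
      = h * h * partial v (partial w f) (z + s' *\<^sub>R w + t' *\<^sub>R v)"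
    using double_mean_value[of h f z w v] dS f smooth_on_partial[OF S f] h
    unfolding swap[of "_ *\<^sub>R w" "_ *\<^sub>R v"] by blast
  have "h * h * partial w (partial v f) (z + s *\<^sub>R v + t *\<^sub>R w)
      = h * h * partial v (partial w f) (z + t' *\<^sub>R v + s' *\<^sub>R w)"
    using 1 2 unfolding swap[of "_ *\<^sub>R w" "_ *\<^sub>R v"] by linarith
  then have "partial w (partial v f) (z + s *\<^sub>R v + t *\<^sub>R w)
      = partial v (partial w f) (z + t' *\<^sub>R v + s' *\<^sub>R w)"
    using h by simp
  moreover have "\<bar>partial w (partial v f) (z + s *\<^sub>R v + t *\<^sub>R w) - partial w (partial v f) z\<bar> < \<epsilon>"
    using small[of s t] st by (intro d2) (simp add: d_def)
  moreover have "\<bar>partial v (partial w f) (z + t' *\<^sub>R v + s' *\<^sub>R w) - partial v (partial w f) z\<bar> < \<epsilon>"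
    using small[of t' s'] st' by (intro d1) (simp add: d_def)
  ultimately show False unfolding \<epsilon>_def by (smt (verit) field_sum_of_halves)
qed

section \<open>Calculus rules for directional derivatives, componentwise rules and the chain
  rule\<close>

lemma partial_add:
  "f differentiable (at z) \<Longrightarrow> g differentiable (at z) \<Longrightarrow>
    partial e (\<lambda>y. f y + g y) z = partial e f z + partial e g z"
  by (rule partial_eqI[OF has_derivative_add[OF has_derivative_partial has_derivative_partial]])

lemma partial_diff:
  "f differentiable (at z) \<Longrightarrow> g differentiable (at z) \<Longrightarrow>
    partial e (\<lambda>y. f y - g y) z = partial e f z - partial e g z"
  by (rule partial_eqI[OF has_derivative_diff[OF has_derivative_partial has_derivative_partial]])

lemma partial_sum:
  "(\<And>i. i \<in> I \<Longrightarrow> f i differentiable (at z)) \<Longrightarrow>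
    partial e (\<lambda>y. \<Sum>i\<in>I. f i y) z = (\<Sum>i\<in>I. partial e (f i) z)"
  by (rule partial_eqI[OF has_derivative_sum[OF has_derivative_partial]])

lemma partial_mult:
  fixes f g :: "'a::euclidean_space \<Rightarrow> real"
  shows "f differentiable (at z) \<Longrightarrow> g differentiable (at z) \<Longrightarrow>
    partial e (\<lambda>y. f y * g y) z = f z * partial e g z + partial e f z * g z"
  by (rule partial_eqI[OF has_derivative_mult[OF has_derivative_partial has_derivative_partial]])

lemma has_derivative_vec_nth:
  fixes F :: "'a::euclidean_space \<Rightarrow> 'b::euclidean_space^'n::finite"
  shows "(F has_derivative F') (at z) \<Longrightarrow> ((\<lambda>y. F y $ i) has_derivative (\<lambda>h. F' h $ i)) (at z)"
  by (rule bounded_linear.has_derivative[OF bounded_linear_vec_nth])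

lemma partial_vec_nth:
  fixes F :: "'a::euclidean_space \<Rightarrow> 'b::euclidean_space^'n::finite"
  shows "F differentiable (at z) \<Longrightarrow> partial e (\<lambda>y. F y $ i) z = partial e F z $ i"
  by (rule partial_eqI[OF has_derivative_vec_nth[OF has_derivative_partial]])

lemma differentiable_vec_nth:
  fixes F :: "'a::euclidean_space \<Rightarrow> 'b::euclidean_space^'n::finite"
  shows "F differentiable (at z) \<Longrightarrow> (\<lambda>y. F y $ i) differentiable (at z)"
  unfolding differentiable_def using has_derivative_vec_nth by blast

text \<open>Basis vectors of the vector type are \<open>axis i c\<close>, and the inner product with
  one reads off component \<open>c\<close> of entry \<open>i\<close>. The entries may themselves be
  vectors, as in the slot of gradients.\<close>

lemma has_derivative_vec_lambda:
  fixes f :: "'n::finite \<Rightarrow> 'a::euclidean_space \<Rightarrow> 'b::euclidean_space"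
  assumes "\<And>i. (f i has_derivative f' i) (at z)"
  shows "((\<lambda>y. \<chi> i. f i y) has_derivative (\<lambda>h. \<chi> i. f' i h)) (at z)"
proof -
  have "((\<lambda>y. (\<chi> i. f i y) \<bullet> b) has_derivative (\<lambda>h. (\<chi> i. f' i h) \<bullet> b)) (at z)"
    if "b \<in> Basis" for b :: "'b^'n"
  proof -
    obtain i c where "b = axis i c" using \<open>b \<in> Basis\<close> by (auto simp: Basis_vec_def)
    then show ?thesis
      using has_derivative_inner_left[OF assms[of i], of c] by (simp add: inner_axis)
  qed
  then show ?thesis by (subst has_derivative_componentwise_within) blast
qed

lemma differentiable_vec_lambda:
  fixes f :: "'n::finite \<Rightarrow> 'a::euclidean_space \<Rightarrow> 'b::euclidean_space"
  shows "(\<And>i. f i differentiable (at z)) \<Longrightarrow> (\<lambda>y. \<chi> i. f i y) differentiable (at z)"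
  unfolding differentiable_def using has_derivative_vec_lambda by metis

lemma partial_pair:
  "f differentiable (at z) \<Longrightarrow> g differentiable (at z) \<Longrightarrow>
    partial e (\<lambda>y. (f y, g y)) z = (partial e f z, partial e g z)"
  by (rule partial_eqI[OF has_derivative_Pair[OF has_derivative_partial has_derivative_partial]])

lemma partial_vec_lambda:
  fixes f :: "'n::finite \<Rightarrow> 'a::euclidean_space \<Rightarrow> 'b::euclidean_space"
  shows "(\<And>i. f i differentiable (at z)) \<Longrightarrow>
    partial e (\<lambda>y. \<chi> i. f i y) z = (\<chi> i. partial e (f i) z)"
  by (rule partial_eqI[OF has_derivative_vec_lambda[OF has_derivative_partial]])

lemma differentiable_pair:
  "f differentiable (at z) \<Longrightarrow> g differentiable (at z) \<Longrightarrow> (\<lambda>y. (f y, g y)) differentiable (at z)"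
  unfolding differentiable_def using has_derivative_Pair by blast

lemma partial_compose:
  assumes "g differentiable (at z)" "f differentiable (at (g z))"
  shows "partial e (\<lambda>y. f (g y)) z = partial (partial e g z) f (g z)"
  by (rule partial_eqI[OF has_derivative_compose[OF assms[THEN has_derivative_partial]]])

lemma linear_vec_expansion:
  fixes g :: "real^'n::finite \<Rightarrow> real"
  assumes "linear g"
  shows "g v = (\<Sum>i\<in>UNIV. v $ i * g (axis i 1))"
proof -
  have "v = (\<Sum>i\<in>UNIV. v $ i *\<^sub>R axis i 1)"
    using basis_expansion[of v] by (simp add: scalar_mult_eq_scaleR)
  then have "g v = g (\<Sum>i\<in>UNIV. v $ i *\<^sub>R axis i 1)" by (rule arg_cong)
  also have "\<dots> = (\<Sum>i\<in>UNIV. v $ i * g (axis i 1))"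
    using assms by (simp add: linear_sum linear_cmul)
  finally show ?thesis .
qed

text \<open>Each \<open>axis j\<close> embeds a row linearly, so the vector expansion applies row by
  row. This serves the slot of the gradients of \<open>\<xi>\<close>, the only matrix slot of a
  Lagrangian.\<close>

lemma linear_mat_expansion:
  fixes g :: "real^'d::finite^'m::finite \<Rightarrow> real"
  assumes "linear g"
  shows "g V = (\<Sum>j\<in>UNIV. \<Sum>i\<in>UNIV. V $ j $ i * g (axis j (axis i 1)))"
proof -
  have lin: "linear (\<lambda>v. g (axis j v))" for j
  proof (rule linearI)
    have "axis j (x + y) = axis j x + axis j y" for x y :: "real^'d"
      by (simp add: axis_def vec_eq_iff)
    then show "g (axis j (x + y)) = g (axis j x) + g (axis j y)" for x y
      by (simp add: linear_add[OF assms])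
    have "axis j (c *\<^sub>R x) = c *\<^sub>R axis j x" for c and x :: "real^'d"
      by (simp add: axis_def vec_eq_iff)
    then show "g (axis j (c *\<^sub>R x)) = c *\<^sub>R g (axis j x)" for c x
      by (simp add: linear_cmul[OF assms])
  qed
  have "V = (\<Sum>j\<in>UNIV. axis j (V $ j))"
    by (simp add: vec_eq_iff axis_def if_distrib [where f="\<lambda>x. x $ _"] cong: if_cong)
  then have "g V = g (\<Sum>j\<in>UNIV. axis j (V $ j))" by (rule arg_cong)
  also have "\<dots> = (\<Sum>j\<in>UNIV. g (axis j (V $ j)))"
    using assms by (simp add: linear_sum)
  also have "\<dots> = (\<Sum>j\<in>UNIV. \<Sum>i\<in>UNIV. V $ j $ i * g (axis j (axis i 1)))"
    by (intro sum.cong refl linear_vec_expansion[OF lin])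
  finally show ?thesis .
qed

subsection \<open>Space-time derivatives\<close>

lemma grad_nth: "grad f z $ i = px i f z"
  by (simp add: grad_def)

text \<open>By linearity in the direction, time and space parts separate. With \<open>v\<close> the
  velocity at \<open>z\<close>, the material derivative becomes a single directional derivative, to
  which the product and chain rules apply directly.\<close>

lemma partial_spacetime:
  fixes f :: "'d::finite spacetime \<Rightarrow> real"
  assumes "f differentiable (at z)"
  shows "partial (1, v) f z = pt f z + v \<bullet> grad f z"
proof -
  note lin = linear_partial[OF assms]
  have "linear (\<lambda>v::real^'d. (0::real, v))"
    by (rule linearI) simp_all
  from linear_compose[OF this lin] have "linear (\<lambda>v. partial (0, v) f z)"
    by (simp add: o_def)
  moreover have "partial (1, v) f z = partial (1, 0) f z + partial (0, v) f z"
    by (simp add: linear_add[OF lin, symmetric])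
  ultimately show ?thesis
    using linear_vec_expansion[of "\<lambda>v. partial (0, v) f z" v]
    by (simp add: pt_def px_def grad_def inner_vec_def)
qed

lemma material_eq_partial:
  "f differentiable (at z) \<Longrightarrow> material u f z = partial (1, u z) f z"
  by (simp add: partial_spacetime material_def)

lemma diverg_add:
  "F differentiable (at z) \<Longrightarrow> G differentiable (at z) \<Longrightarrow>
    diverg (\<lambda>y. F y + G y) z = diverg F z + diverg G z"
  by (simp add: diverg_def px_def partial_add differentiable_vec_nth sum.distrib)

lemma diverg_diff:
  "F differentiable (at z) \<Longrightarrow> G differentiable (at z) \<Longrightarrow>
    diverg (\<lambda>y. F y - G y) z = diverg F z - diverg G z"
  by (simp add: diverg_def px_def partial_diff differentiable_vec_nth sum_subtractf)

lemma diverg_sum: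
  assumes "\<And>i. i \<in> I \<Longrightarrow> F i differentiable (at z)"
  shows "diverg (\<lambda>y. \<Sum>i\<in>I. F i y) z = (\<Sum>i\<in>I. diverg (F i) z)"
  unfolding diverg_def px_def sum_component
  by (subst sum.swap) (intro sum.cong refl partial_sum differentiable_vec_nth assms)

lemma diverg_scaleR:
  "f differentiable (at z) \<Longrightarrow> F differentiable (at z) \<Longrightarrow>
    diverg (\<lambda>y. f y *\<^sub>R F y) z = f z * diverg F z + grad f z \<bullet> F z"
  by (simp add: diverg_def px_def grad_def inner_vec_def partial_mult differentiable_vec_nth
      sum.distrib sum_distrib_left)

lemma diverg_const: "diverg (\<lambda>y. c) z = 0"
  by (simp add: diverg_def px_def partial_eqI[OF has_derivative_const])

text \<open>The product rule turns a conservative balance into material form; it is used for the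
  mass, for each \<open>M_field\<close> and for the Hamiltonian.\<close>

lemma pt_plus_diverg:
  assumes "f differentiable (at z)" "u differentiable (at z)"
  shows "pt f z + diverg (\<lambda>y. f y *\<^sub>R u y) z = material u f z + f z * diverg u z"
  using assms by (simp add: diverg_scaleR material_def inner_commute)

text \<open>Rests on \<open>(a d^T)^T x = (x . a) d\<close>, and evaluates the term
  \<open>Pi^T u\<close> of the energy flux.\<close>

lemma transpose_diff_outer_mult_vec:
  fixes x :: "real^'n::finite"
  shows "transpose (c *\<^sub>R mat 1 - (\<Sum>j\<in>S. a j \<otimes>\<^sub>v d j)) *v x = c *\<^sub>R x - (\<Sum>j\<in>S. (x \<bullet> a j) *\<^sub>R d j)"
proof -
  have "(\<Sum>r\<in>UNIV. (c * (if r = i then 1 else 0) - (\<Sum>j\<in>S. a j $ r * d j $ i)) * x $ r)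
      = c * x $ i - (\<Sum>j\<in>S. (x \<bullet> a j) * d j $ i)" for i
  proof -
    have "(\<Sum>r\<in>UNIV. (\<Sum>j\<in>S. a j $ r * d j $ i) * x $ r) = (\<Sum>j\<in>S. (x \<bullet> a j) * d j $ i)"
      unfolding sum_distrib_right inner_vec_def
      by (subst sum.swap) (simp add: mult_ac)
    moreover have "(\<Sum>r\<in>UNIV. c * (if r = i then 1 else 0) * x $ r) = c * x $ i"
      by (simp add: mult.assoc sum_distrib_left[symmetric] if_distrib[of "\<lambda>t. t * _"] cong: if_cong)
    ultimately show ?thesis
      by (simp add: left_diff_distrib sum_subtractf)
  qed
  then show ?thesis
    by (simp add: vec_eq_iff matrix_vector_mult_def transpose_def mat_def outer_def sum_component)
qed

subsection \<open>Differentials of Lagrangians\<close>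

text \<open>The total differential of \<open>L\<close>: a direction is the sum of its seven slot
  embeddings, and each is expanded in coordinates. The derivatives in the third slot stay unnamed;
  in the energy balance the constraint on \<open>b\<close> removes them.\<close>

lemma partial_args:
  fixes L :: "('d::finite, 'n::finite, 'o::finite, 'm::finite) lagrangian"
  assumes "L differentiable (at a)"
  shows "partial (\<alpha>, v, \<beta>, \<beta>', x, G, w) L a =
    \<alpha> * d_mass L a + v \<bullet> d_vel L a
    + (\<Sum>i\<in>UNIV. \<beta> $ i * partial (0, 0, axis i 1, 0, 0, 0, 0) L a)
    + (\<Sum>i\<in>UNIV. \<beta>' $ i * d_other L i a) + (\<Sum>j\<in>UNIV. x $ j * d_xi L j a)
    + (\<Sum>j\<in>UNIV. G $ j \<bullet> d_grad_xi L j a) + (\<Sum>j\<in>UNIV. w $ j * d_Dt_xi L j a)"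
proof -
  define p where "p e = partial e L a" for e
  have lin: "linear p" unfolding p_def by (rule linear_partial[OF assms])
  have slot: "linear (\<lambda>v. p (h v))" if "linear h" for h :: "'z::real_vector \<Rightarrow> _"
    using linear_compose[OF that lin] by (simp add: o_def)
  have "p (\<alpha>, v, \<beta>, \<beta>', x, G, w) = p (\<alpha> *\<^sub>R (1, 0, 0, 0, 0, 0, 0) + (0, v, 0, 0, 0, 0, 0)
      + (0, 0, \<beta>, 0, 0, 0, 0) + (0, 0, 0, \<beta>', 0, 0, 0) + (0, 0, 0, 0, x, 0, 0)
      + (0, 0, 0, 0, 0, G, 0) + (0, 0, 0, 0, 0, 0, w))"
    by simp
  also have "\<dots> = \<alpha> * p (1, 0, 0, 0, 0, 0, 0) + p (0, v, 0, 0, 0, 0, 0)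
      + p (0, 0, \<beta>, 0, 0, 0, 0) + p (0, 0, 0, \<beta>', 0, 0, 0) + p (0, 0, 0, 0, x, 0, 0)
      + p (0, 0, 0, 0, 0, G, 0) + p (0, 0, 0, 0, 0, 0, w)"
    by (simp only: linear_add[OF lin] linear_cmul[OF lin] real_scaleR_def)
  also have "p (0, v, 0, 0, 0, 0, 0) = (\<Sum>i\<in>UNIV. v $ i * p (0, axis i 1, 0, 0, 0, 0, 0))"
    by (intro linear_vec_expansion slot linearI) simp_all
  also have "p (0, 0, \<beta>, 0, 0, 0, 0) = (\<Sum>i\<in>UNIV. \<beta> $ i * p (0, 0, axis i 1, 0, 0, 0, 0))"
    by (intro linear_vec_expansion slot linearI) simp_all
  also have "p (0, 0, 0, \<beta>', 0, 0, 0) = (\<Sum>i\<in>UNIV. \<beta>' $ i * p (0, 0, 0, axis i 1, 0, 0, 0))"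
    by (intro linear_vec_expansion slot linearI) simp_all
  also have "p (0, 0, 0, 0, x, 0, 0) = (\<Sum>i\<in>UNIV. x $ i * p (0, 0, 0, 0, axis i 1, 0, 0))"
    by (intro linear_vec_expansion slot linearI) simp_all
  also have "p (0, 0, 0, 0, 0, G, 0) =
      (\<Sum>j\<in>UNIV. \<Sum>i\<in>UNIV. G $ j $ i * p (0, 0, 0, 0, 0, axis j (axis i 1), 0))"
    by (intro linear_mat_expansion slot linearI) simp_all
  also have "p (0, 0, 0, 0, 0, 0, w) = (\<Sum>i\<in>UNIV. w $ i * p (0, 0, 0, 0, 0, 0, axis i 1))"
    by (intro linear_vec_expansion slot linearI) simp_all
  finally show ?thesis
    by (simp add: p_def d_mass_def d_vel_def d_other_def d_xi_def d_grad_xi_def d_Dt_xi_def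
        inner_vec_def)
qed

subsection \<open>Energy balance of one phase\<close>

text \<open>The data of either phase, so that the energy balance is proved once and interpreted
  twice with the roles exchanged. The primed family is that of the other phase, and \<open>U\<close>
  is an open set of arguments on which \<open>L\<close> is smooth.\<close>

locale phase =
  fixes \<Omega> :: "'d::finite spacetime set"
    and L :: "('d, 'n::finite, 'o::finite, 'm::finite) lagrangian"
    and U :: "('d, 'n, 'o, 'm) args set"
    and m :: "'d spacetime \<Rightarrow> real"
    and u :: "'d spacetime \<Rightarrow> real^'d"
    and b :: "'n \<Rightarrow> 'd spacetime \<Rightarrow> real"
    and b' :: "'o \<Rightarrow> 'd spacetime \<Rightarrow> real"
    and \<xi> :: "'m \<Rightarrow> 'd spacetime \<Rightarrow> real"
    and A :: "('d, 'n, 'o, 'm) state"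
  assumes open_domain: "open \<Omega>"
    and open_U: "open U" and smooth_L: "smooth_on U L"
    and smooth_m: "smooth_on \<Omega> m" and smooth_u: "smooth_on \<Omega> u"
    and smooth_b: "\<And>i. smooth_on \<Omega> (b i)" and smooth_b': "\<And>i. smooth_on \<Omega> (b' i)"
    and smooth_\<xi>: "\<And>j. smooth_on \<Omega> (\<xi> j)"
    and A_eq: "A = state m u b b' \<xi>"
    and A_in_U: "\<And>z. z \<in> \<Omega> \<Longrightarrow> A z \<in> U"
begin

abbreviation "H \<equiv> partial_hamiltonian L A u \<xi>"

definition energy_flux :: "'d spacetime \<Rightarrow> real^'d" where
  "energy_flux y = H y *\<^sub>R u y + transpose (Pi_field L A m \<xi> y) *v u y
    + (\<Sum>j\<in>UNIV. material u (\<xi> j) y *\<^sub>R D_field L A j y)"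

text \<open>The coefficient of the identity in \<open>Pi_field\<close>. For kinetic energy minus an
  internal energy \<open>e(m)\<close> per unit volume it is \<open>m e'(m) - e(m)\<close>.\<close>

definition pressure :: "'d spacetime \<Rightarrow> real" where
  "pressure y = L (A y) - m y * d_mass L (A y)"

context
  fixes z assumes z: "z \<in> \<Omega>"
begin

section \<open>Differentiability of the fields of one phase at a point of the domain\<close>

lemma differentiable_fields [simp]:
  "m differentiable (at z)" "u differentiable (at z)" "b i differentiable (at z)"
  "b' k differentiable (at z)" "\<xi> j differentiable (at z)"
  using z smooth_m smooth_u smooth_b smooth_b' smooth_\<xi> by (auto intro: smooth_on_differentiable)

lemma differentiable_partial_\<xi> [simp]: "partial e (\<xi> j) differentiable (at z)"
  using smooth_on_partial[OF open_domain smooth_\<xi>] z by (rule smooth_on_differentiable)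

lemma differentiable_pt_\<xi> [simp]: "pt (\<xi> j) differentiable (at z)"
  by (simp add: pt_def)

lemma differentiable_grad_\<xi> [simp]: "grad (\<xi> j) differentiable (at z)"
proof -
  have "grad (\<xi> j) = (\<lambda>y. \<chi> i. px i (\<xi> j) y)" by (auto simp: grad_def)
  then show ?thesis by (simp add: differentiable_vec_lambda px_def)
qed

lemma differentiable_material_\<xi> [simp]: "material u (\<xi> j) differentiable (at z)"
proof -
  have "material u (\<xi> j) = (\<lambda>y. pt (\<xi> j) y + u y \<bullet> grad (\<xi> j) y)" by (auto simp: material_def)
  then show ?thesis by simp
qed

lemma state_eq: "A = (\<lambda>y. (m y, u y, \<chi> i. b i y, \<chi> i. b' i y, \<chi> j. \<xi> j y, \<chi> j. grad (\<xi> j) y,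
    \<chi> j. material u (\<xi> j) y))"
  by (auto simp: A_eq state_def)

lemma differentiable_state: "A differentiable (at z)"
  unfolding state_eq by (intro differentiable_pair differentiable_vec_lambda) simp_all

lemma partial_state:
  "partial e A z = (partial e m z, partial e u z, \<chi> i. partial e (b i) z, \<chi> i. partial e (b' i) z,
    \<chi> j. partial e (\<xi> j) z, \<chi> j. partial e (grad (\<xi> j)) z, \<chi> j. partial e (material u (\<xi> j)) z)"
  unfolding state_eq by (simp add: partial_pair partial_vec_lambda differentiable_pair differentiable_vec_lambda)

lemma differentiable_L: "L differentiable (at (A z))"
  using smooth_on_differentiable[OF smooth_L A_in_U[OF z]] .

lemma differentiable_partial_L: "(\<lambda>y. partial e L (A y)) differentiable (at z)"
  using smooth_on_differentiable[OF smooth_on_partial[OF open_U smooth_L] A_in_U[OF z]] differentiable_state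
  by (rule differentiable_compose)

lemma differentiable_derived_fields [simp]:
  "(\<lambda>y. L (A y)) differentiable (at z)"
  "K_field L A differentiable (at z)"
  "M_field L A j differentiable (at z)"
  "D_field L A j differentiable (at z)"
proof -
  show "(\<lambda>y. L (A y)) differentiable (at z)"
    using differentiable_L differentiable_state by (rule differentiable_compose)
  have "K_field L A = (\<lambda>y. \<chi> i. partial (0, axis i 1, 0, 0, 0, 0, 0) L (A y))"
    by (auto simp: K_field_def d_vel_def)
  then show "K_field L A differentiable (at z)"
    by (simp add: differentiable_vec_lambda differentiable_partial_L)
  have "M_field L A j = (\<lambda>y. partial (0, 0, 0, 0, 0, 0, axis j 1) L (A y))"
    by (auto simp: M_field_def d_Dt_xi_def)
  then show "M_field L A j differentiable (at z)"
    by (simp add: differentiable_partial_L)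
  have "D_field L A j = (\<lambda>y. \<chi> i. partial (0, 0, 0, 0, 0, axis j (axis i 1), 0) L (A y))"
    by (auto simp: D_field_def d_grad_xi_def)
  then show "D_field L A j differentiable (at z)"
    by (simp add: differentiable_vec_lambda differentiable_partial_L)
qed

lemma differentiable_pressure [simp]: "pressure differentiable (at z)"
proof -
  have "pressure = (\<lambda>y. L (A y) - m y * partial (1, 0, 0, 0, 0, 0, 0) L (A y))"
    by (auto simp: pressure_def d_mass_def)
  then show ?thesis by (simp add: differentiable_partial_L)
qed

lemma differentiable_hamiltonian [simp]: "H differentiable (at z)"
proof -
  have "H = (\<lambda>y. K_field L A y \<bullet> u y + (\<Sum>j\<in>UNIV. M_field L A j y * material u (\<xi> j) y) - L (A y))"
    by (auto simp: partial_hamiltonian_def)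
  then show ?thesis by simp
qed

text \<open>The transport part \<open>u \<cdot> \<nabla>\<xi>\<^sub>j\<close> of \<open>D\<^sub>t \<xi>\<^sub>j\<close> cancels against the off-diagonal part of the pressure tensor.\<close>

lemma energy_flux_eq:
  "energy_flux = (\<lambda>y. H y *\<^sub>R u y + pressure y *\<^sub>R u y + (\<Sum>j\<in>UNIV. pt (\<xi> j) y *\<^sub>R D_field L A j y))"
  by (rule ext) (simp add: energy_flux_def Pi_field_def transpose_diff_outer_mult_vec pressure_def
      material_def scaleR_add_left sum.distrib del: transpose_matrix_vector)

lemma differentiable_energy_flux: "energy_flux differentiable (at z)"
  unfolding energy_flux_eq by simp

section \<open>Chain rule along the state and divergence of the momentum flux\<close>

lemma partial_L:
  "partial e (\<lambda>y. L (A y)) z = partial e m z * d_mass L (A z) + partial e u z \<bullet> K_field L A z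
    + (\<Sum>i\<in>UNIV. partial e (b i) z * partial (0, 0, axis i 1, 0, 0, 0, 0) L (A z))
    + (\<Sum>i\<in>UNIV. partial e (b' i) z * d_other L i (A z))
    + (\<Sum>j\<in>UNIV. partial e (\<xi> j) z * d_xi L j (A z))
    + (\<Sum>j\<in>UNIV. partial e (grad (\<xi> j)) z \<bullet> D_field L A j z)
    + (\<Sum>j\<in>UNIV. partial e (material u (\<xi> j)) z * M_field L A j z)"
  using trans[OF partial_compose[OF differentiable_state differentiable_L, of e, unfolded partial_state]
      partial_args[OF differentiable_L]]
  by (simp add: K_field_def D_field_def M_field_def)

lemma diverg_momentum_flux:
  "diverg_mat (\<lambda>y. K_field L A y \<otimes>\<^sub>v u y + Pi_field L A m \<xi> y) z $ r =
    K_field L A z $ r * diverg u z + grad (\<lambda>y. K_field L A y $ r) z \<bullet> u z + grad pressure z $ r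
    - (\<Sum>j\<in>UNIV. grad (\<xi> j) z $ r * diverg (D_field L A j) z + grad (px r (\<xi> j)) z \<bullet> D_field L A j z)"
proof -
  \<comment> \<open>Row \<open>r\<close> of the flux is a sum of scalar fields times vector fields,
    with \<open>pressure\<close> multiplying the \<open>r\<close>-th unit vector, so the product
    rule for \<open>diverg\<close> applies termwise.\<close>
  have row: "(\<lambda>y. (K_field L A y \<otimes>\<^sub>v u y + Pi_field L A m \<xi> y) $ r) = (\<lambda>y. K_field L A y $ r *\<^sub>R u y
      + pressure y *\<^sub>R axis r 1 - (\<Sum>j\<in>UNIV. px r (\<xi> j) y *\<^sub>R D_field L A j y))"
    by (auto simp: vec_eq_iff outer_def Pi_field_def pressure_def grad_nth mat_def axis_def sum_component)
  have [simp]: "px r (\<xi> j) differentiable (at z)" for j by (simp add: px_def)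
  have "diverg_mat (\<lambda>y. K_field L A y \<otimes>\<^sub>v u y + Pi_field L A m \<xi> y) z $ r
      = diverg (\<lambda>y. (K_field L A y \<otimes>\<^sub>v u y + Pi_field L A m \<xi> y) $ r) z"
    by (simp only: diverg_mat_def vec_lambda_beta)
  also have "\<dots> = K_field L A z $ r * diverg u z + grad (\<lambda>y. K_field L A y $ r) z \<bullet> u z
      + grad pressure z $ r
      - (\<Sum>j\<in>UNIV. grad (\<xi> j) z $ r * diverg (D_field L A j) z + grad (px r (\<xi> j)) z \<bullet> D_field L A j z)"
    unfolding row
    by (simp add: diverg_diff diverg_add diverg_sum diverg_scaleR diverg_const inner_axis
        differentiable_vec_nth grad_nth)
  finally show ?thesis .
qed

text \<open>By symmetry of second derivatives, \<open>D\<^sub>t \<nabla>\<xi>\<^sub>j = \<nabla>\<partial>\<^sub>t\<xi>\<^sub>j + (u \<cdot> \<nabla>)\<nabla>\<xi>\<^sub>j\<close>.\<close>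

lemma partial_grad_\<xi>:
  "partial (1, u z) (grad (\<xi> j)) z \<bullet> v =
    grad (pt (\<xi> j)) z \<bullet> v + (\<Sum>r\<in>UNIV. u z $ r * (grad (px r (\<xi> j)) z \<bullet> v))"
proof -
  have comm: "partial e (partial e' (\<xi> j)) z = partial e' (partial e (\<xi> j)) z" for e e'
    using open_domain smooth_\<xi> z by (rule partial_commute)
  have "partial (1, u z) (grad (\<xi> j)) z $ c
      = grad (pt (\<xi> j)) z $ c + (\<Sum>r\<in>UNIV. u z $ r * grad (px r (\<xi> j)) z $ c)" for c
  proof -
    have "partial (1, u z) (grad (\<xi> j)) z $ c = partial (1, u z) (px c (\<xi> j)) z"
      using partial_vec_nth[OF differentiable_grad_\<xi>, of "(1, u z)" j c, symmetric]
      by (simp add: grad_def)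
    also have "\<dots> = pt (px c (\<xi> j)) z + u z \<bullet> grad (px c (\<xi> j)) z"
      by (rule partial_spacetime) (simp add: px_def)
    finally show ?thesis
      by (simp add: inner_vec_def grad_def px_def pt_def comm)
  qed
  moreover have "(\<Sum>c\<in>UNIV. (\<Sum>r\<in>UNIV. u z $ r * grad (px r (\<xi> j)) z $ c) * v $ c)
      = (\<Sum>r\<in>UNIV. u z $ r * (grad (px r (\<xi> j)) z \<bullet> v))"
    unfolding inner_vec_def sum_distrib_left sum_distrib_right
    by (subst sum.swap) (simp add: mult_ac)
  ultimately show ?thesis
    by (simp add: inner_vec_def distrib_right sum.distrib)
qed

text \<open>Three identities are combined linearly: \<open>lhs\<close> for the left-hand side,
  \<open>DL\<close> for the chain rule, and \<open>mom_u\<close> for the momentum equation paired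
  with \<open>u\<close>. The other phase enters only through the coefficients
  \<open>d_other L' i (A' z)\<close>.\<close>

lemma hamiltonian_equation:
  assumes constr: "phase_constraints \<Omega> m u b"
    and mom: "momentum_equation \<Omega> L A L' A' m u b b' \<xi>"
  shows "pt H z + diverg energy_flux z
    = (\<Sum>i\<in>UNIV. d_other L' i (A' z) * pt (b i) z) - (\<Sum>i\<in>UNIV. d_other L i (A z) * pt (b' i) z)
      + (\<Sum>j\<in>UNIV. xi_bracket L A u j z * pt (\<xi> j) z)"
proof -
  \<comment> \<open>The direction of the material derivative, with the velocity frozen at
    \<open>z\<close>; this is legitimate because each derivative along it is evaluated at
    \<open>z\<close> only.\<close>
  let ?w = "(1, u z)"
  let ?K = "K_field L A" and ?M = "M_field L A" and ?D = "D_field L A"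
  let ?\<delta> = "diverg u z"
  \<comment> \<open>Naming the scalars leaves only linear relations between sums for the final
    cancellation. \<open>\<tau>\<close> and \<open>g\<close> split \<open>W\<close> into time and
    transport parts; \<open>X\<close> and \<open>Y\<close> split the second derivatives of
    \<open>\<xi>\<close> likewise.\<close>
  define W where "W j = material u (\<xi> j) z" for j
  define g where "g j = u z \<bullet> grad (\<xi> j) z" for j
  define \<tau> where "\<tau> j = pt (\<xi> j) z" for j
  define X where "X j = grad (pt (\<xi> j)) z \<bullet> ?D j z" for j
  define Y where "Y j = (\<Sum>r\<in>UNIV. u z $ r * (grad (px r (\<xi> j)) z \<bullet> ?D j z))" for j
  define S where "S i = d_other L i (A z)" for i
  define S' where "S' i = d_other L' i (A' z)" for i
  define B where "B j = xi_bracket L A u j z" for j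
  define Q where "Q j = d_xi L j (A z)" for j
  define dD where "dD j = diverg (?D j) z" for j
  define DM where "DM j = partial ?w (?M j) z" for j
  define DW where "DW j = partial ?w (material u (\<xi> j)) z" for j
  define M where "M j = ?M j z" for j
  define DK where "DK = partial ?w ?K z \<bullet> u z"
  define KDu where "KDu = ?K z \<bullet> partial ?w u z"
  define up where "up = u z \<bullet> grad pressure z"

  have Wj: "W j = \<tau> j + g j" for j
    by (simp add: W_def \<tau>_def g_def material_def)
  have Bj: "B j = DM j + M j * ?\<delta> + dD j - Q j" for j
    using pt_plus_diverg[of "?M j" z u]
    by (simp add: B_def xi_bracket_def DM_def M_def dD_def Q_def material_eq_partial)
  have mass: "partial ?w m z = - (m z * ?\<delta>)"
    using constr z pt_plus_diverg[of m z u]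
    by (auto simp: phase_constraints_def material_eq_partial)
  have Db: "partial ?w (b i) z = 0" for i
    using constr z material_eq_partial[of "b i" z u] by (simp add: phase_constraints_def)
  have b_eq: "u z \<bullet> grad (b i) z = - pt (b i) z" for i
    using Db[of i] by (simp add: partial_spacetime)
  \<comment> \<open>The family \<open>b'\<close> is transported by the other velocity, so its
    derivative along \<open>?w\<close> need not vanish. Its transport part cancels against
    \<open>mom_u\<close>, which leaves the time derivative.\<close>
  have b'_eq: "partial ?w (b' i) z = pt (b' i) z + u z \<bullet> grad (b' i) z" for i
    by (simp add: partial_spacetime)

  have lhs: "pt H z + diverg energy_flux z = partial ?w H z + H z * ?\<delta> + up + pressure z * ?\<delta>
      + (\<Sum>j\<in>UNIV. \<tau> j * dD j + X j)"
    unfolding energy_flux_eq using pt_plus_diverg[of H z u]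
    by (simp add: diverg_add diverg_sum diverg_scaleR material_eq_partial \<tau>_def dD_def X_def up_def
        inner_commute)
  have H_eq: "H = (\<lambda>y. (\<Sum>r\<in>UNIV. ?K y $ r * u y $ r)
      + (\<Sum>j\<in>UNIV. ?M j y * material u (\<xi> j) y) - L (A y))"
    by (auto simp: partial_hamiltonian_def inner_vec_def)
  have DH: "partial ?w H z = DK + KDu + (\<Sum>j\<in>UNIV. DM j * W j + M j * DW j)
      - partial ?w (\<lambda>y. L (A y)) z"
    unfolding H_eq
    by (simp add: partial_diff partial_add partial_sum partial_mult partial_vec_nth differentiable_vec_nth
        DK_def KDu_def inner_vec_def DM_def W_def M_def DW_def sum.distrib add_ac)
  \<comment> \<open>\<open>KDu\<close> and the sum of \<open>M j * DW j\<close> also occur in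
    \<open>DH\<close>, where they cancel: this is the Legendre structure of
    \<open>H\<close>.\<close>
  have DL: "partial ?w (\<lambda>y. L (A y)) z = - (m z * ?\<delta>) * d_mass L (A z) + KDu
      + (\<Sum>i\<in>UNIV. S i * (pt (b' i) z + u z \<bullet> grad (b' i) z))
      + (\<Sum>j\<in>UNIV. W j * Q j) + (\<Sum>j\<in>UNIV. X j + Y j) + (\<Sum>j\<in>UNIV. M j * DW j)"
    unfolding partial_L mass Db b'_eq partial_grad_\<xi>
    by (simp add: KDu_def S_def Q_def X_def Y_def M_def DW_def W_def material_eq_partial mult_ac inner_commute)

  define E where "E r = (\<Sum>j\<in>UNIV. grad (\<xi> j) z $ r * dD j + grad (px r (\<xi> j)) z \<bullet> ?D j z)" for r
  have momr: "partial ?w ?K z $ r + ?K z $ r * ?\<delta> + grad pressure z $ r - E r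
      = - (\<Sum>j\<in>UNIV. B j * grad (\<xi> j) z $ r) + (\<Sum>i\<in>UNIV. S i * grad (b' i) z $ r)
        - (\<Sum>i\<in>UNIV. S' i * grad (b i) z $ r)" for r
  proof -
    have "partial ?w ?K z $ r = pt ?K z $ r + grad (\<lambda>y. ?K y $ r) z \<bullet> u z"
      using partial_spacetime[of "\<lambda>y. ?K y $ r" z "u z"]
      by (simp add: partial_vec_nth differentiable_vec_nth pt_def inner_commute)
    moreover have "(pt ?K z + diverg_mat (\<lambda>y. ?K y \<otimes>\<^sub>v u y + Pi_field L A m \<xi> y) z) $ r =
      (- (\<Sum>j\<in>UNIV. xi_bracket L A u j z *\<^sub>R grad (\<xi> j) z)
      + (\<Sum>i\<in>UNIV. d_other L i (A z) *\<^sub>R grad (b' i) z)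
      - (\<Sum>i\<in>UNIV. d_other L' i (A' z) *\<^sub>R grad (b i) z)) $ r"
      using mom z by (simp add: momentum_equation_def)
    ultimately show ?thesis
      by (simp add: diverg_momentum_flux sum_component B_def S_def S'_def dD_def E_def)
  qed
  \<comment> \<open>Contraction with \<open>u\<close> is moved inside the sums over \<open>i\<close>
    and \<open>j\<close>, turning components of gradients into transport terms.\<close>
  have pull: "(\<Sum>r\<in>UNIV. u z $ r * (\<Sum>i\<in>I. f i * v i $ r)) = (\<Sum>i\<in>I. f i * (u z \<bullet> v i))"
    for I :: "'i set" and f and v :: "'i \<Rightarrow> real^'d"
    unfolding inner_vec_def sum_distrib_left by (subst sum.swap) (simp add: mult_ac)
  have pull': "(\<Sum>r\<in>UNIV. u z $ r * E r) = (\<Sum>j\<in>UNIV. g j * dD j + Y j)"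
  proof -
    have "(\<Sum>r\<in>UNIV. u z $ r * E r) = (\<Sum>r\<in>UNIV. \<Sum>j\<in>UNIV.
        u z $ r * grad (\<xi> j) z $ r * dD j + u z $ r * (grad (px r (\<xi> j)) z \<bullet> ?D j z))"
      by (simp add: E_def sum_distrib_left distrib_left mult.assoc)
    also have "\<dots> = (\<Sum>j\<in>UNIV. \<Sum>r\<in>UNIV.
        u z $ r * grad (\<xi> j) z $ r * dD j + u z $ r * (grad (px r (\<xi> j)) z \<bullet> ?D j z))"
      by (rule sum.swap)
    also have "\<dots> = (\<Sum>j\<in>UNIV. g j * dD j + Y j)"
      by (simp add: g_def Y_def inner_vec_def[of "u z"] sum_distrib_right sum.distrib)
    finally show ?thesis .
  qed
  have "(\<Sum>r\<in>UNIV. u z $ r * (partial ?w ?K z $ r + ?K z $ r * ?\<delta> + grad pressure z $ r - E r))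
      = (\<Sum>r\<in>UNIV. u z $ r * (- (\<Sum>j\<in>UNIV. B j * grad (\<xi> j) z $ r) + (\<Sum>i\<in>UNIV. S i * grad (b' i) z $ r)
        - (\<Sum>i\<in>UNIV. S' i * grad (b i) z $ r)))"
    by (simp only: momr)
  moreover have "(\<Sum>r\<in>UNIV. u z $ r * (partial ?w ?K z $ r + ?K z $ r * ?\<delta> + grad pressure z $ r - E r))
      = DK + (?K z \<bullet> u z) * ?\<delta> + up - (\<Sum>j\<in>UNIV. g j * dD j + Y j)"
    unfolding right_diff_distrib distrib_left sum_subtractf pull'[symmetric]
    by (simp add: DK_def up_def inner_vec_def sum_distrib_left sum.distrib mult_ac)
  moreover have "(\<Sum>r\<in>UNIV. u z $ r * (- (\<Sum>j\<in>UNIV. B j * grad (\<xi> j) z $ r)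
        + (\<Sum>i\<in>UNIV. S i * grad (b' i) z $ r) - (\<Sum>i\<in>UNIV. S' i * grad (b i) z $ r)))
      = - (\<Sum>j\<in>UNIV. B j * g j) + (\<Sum>i\<in>UNIV. S i * (u z \<bullet> grad (b' i) z))
        - (\<Sum>i\<in>UNIV. S' i * (u z \<bullet> grad (b i) z))"
    by (simp add: right_diff_distrib distrib_left sum_subtractf sum.distrib sum_negf pull g_def)
  ultimately have mom_u: "DK + (?K z \<bullet> u z) * ?\<delta> + up - (\<Sum>j\<in>UNIV. g j * dD j + Y j)
      = - (\<Sum>j\<in>UNIV. B j * g j) + (\<Sum>i\<in>UNIV. S i * (u z \<bullet> grad (b' i) z))
        + (\<Sum>i\<in>UNIV. S' i * pt (b i) z)"
    by (simp add: b_eq sum_negf)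

  have Hz: "H z = ?K z \<bullet> u z + (\<Sum>j\<in>UNIV. M j * W j) - L (A z)"
    by (simp add: partial_hamiltonian_def M_def W_def)
  have pz: "pressure z = L (A z) - m z * d_mass L (A z)"
    by (simp add: pressure_def)
  \<comment> \<open>Since \<open>\<tau> = W - g\<close>, \<open>Bj\<close> expands
    \<open>B * W\<close> and leaves \<open>B * g\<close> to match \<open>mom_u\<close>.
    \<open>X\<close> and \<open>Y\<close> are added and subtracted to form the groups found in
    \<open>lhs\<close>, \<open>mom_u\<close> and \<open>DL\<close>.\<close>
  have "(\<Sum>j\<in>UNIV. B j * \<tau> j) = (\<Sum>j\<in>UNIV. DM j * W j + M j * W j * ?\<delta> + (\<tau> j * dD j + X j)
      + (g j * dD j + Y j) - W j * Q j - (X j + Y j) - B j * g j)"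
    by (intro sum.cong refl) (simp add: Wj Bj algebra_simps)
  also have "\<dots> = (\<Sum>j\<in>UNIV. DM j * W j) + (\<Sum>j\<in>UNIV. M j * W j) * ?\<delta> + (\<Sum>j\<in>UNIV. \<tau> j * dD j + X j)
      + (\<Sum>j\<in>UNIV. g j * dD j + Y j) - (\<Sum>j\<in>UNIV. W j * Q j) - (\<Sum>j\<in>UNIV. X j + Y j) - (\<Sum>j\<in>UNIV. B j * g j)"
    by (simp add: sum.distrib sum_subtractf sum_distrib_right)
  \<comment> \<open>The multiples of \<open>L (A z)\<close> in \<open>H z * ?\<delta>\<close> and
    \<open>pressure z * ?\<delta>\<close> cancel, and the mass term of the pressure cancels the one
    that continuity produced in \<open>DL\<close>.\<close>
  finally have "pt H z + diverg energy_flux z = (\<Sum>i\<in>UNIV. S' i * pt (b i) z)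
      - (\<Sum>i\<in>UNIV. S i * pt (b' i) z) + (\<Sum>j\<in>UNIV. B j * \<tau> j)"
    unfolding lhs DH DL Hz pz using mom_u
    by (simp add: algebra_simps sum.distrib)
  then show ?thesis by (simp add: S'_def S_def B_def \<tau>_def)
qed

end

end

subsection \<open>Supplementary conservation law\<close>

theorem theorem2p2:
  fixes \<Omega> :: "'d::finite spacetime set"
    and L1 :: "('d, 'n1::finite, 'n2::finite, 'm::finite) lagrangian"
    and L2 :: "('d, 'n2, 'n1, 'm) lagrangian"
    and U1 :: "('d, 'n1, 'n2, 'm) args set"
    and U2 :: "('d, 'n2, 'n1, 'm) args set"
    and m1 m2 :: "'d spacetime \<Rightarrow> real"
    and u1 u2 :: "'d spacetime \<Rightarrow> real^'d"
    and b1 :: "'n1 \<Rightarrow> 'd spacetime \<Rightarrow> real"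
    and b2 :: "'n2 \<Rightarrow> 'd spacetime \<Rightarrow> real"
    and \<xi> :: "'m \<Rightarrow> 'd spacetime \<Rightarrow> real"
    and A1 :: "('d, 'n1, 'n2, 'm) state"
    and A2 :: "('d, 'n2, 'n1, 'm) state"
    and H1 H2 :: "'d spacetime \<Rightarrow> real"
  assumes "open \<Omega>"
    and "open U1" and "smooth_on U1 L1"
    and "open U2" and "smooth_on U2 L2"
    and "smooth_on \<Omega> m1" and "smooth_on \<Omega> m2"
    and "smooth_on \<Omega> u1" and "smooth_on \<Omega> u2"
    and "\<And>i. smooth_on \<Omega> (b1 i)" and "\<And>i. smooth_on \<Omega> (b2 i)"
    and "\<And>j. smooth_on \<Omega> (\<xi> j)"
    and A1_eq: "A1 = state m1 u1 b1 b2 \<xi>"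
    and A2_eq: "A2 = state m2 u2 b2 b1 \<xi>"
    and "\<And>z. z \<in> \<Omega> \<Longrightarrow> A1 z \<in> U1"
    and "\<And>z. z \<in> \<Omega> \<Longrightarrow> A2 z \<in> U2"
    and "generic_system \<Omega> L1 L2 m1 m2 u1 u2 b1 b2 \<xi>"
    and H1_eq: "H1 = partial_hamiltonian L1 A1 u1 \<xi>"
    and H2_eq: "H2 = partial_hamiltonian L2 A2 u2 \<xi>"
  shows "(\<forall>z\<in>\<Omega>. pt (\<lambda>y. H1 y + H2 y) z
            + diverg (\<lambda>y. H1 y *\<^sub>R u1 y + H2 y *\<^sub>R u2 y
                + transpose (Pi_field L1 A1 m1 \<xi> y) *v u1 y
                + transpose (Pi_field L2 A2 m2 \<xi> y) *v u2 y
                + (\<Sum>j\<in>UNIV. material u1 (\<xi> j) y *\<^sub>R D_field L1 A1 j y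
                           + material u2 (\<xi> j) y *\<^sub>R D_field L2 A2 j y)) z = 0)
       \<and> (\<forall>z\<in>\<Omega>. pt H1 z
            + diverg (\<lambda>y. H1 y *\<^sub>R u1 y + transpose (Pi_field L1 A1 m1 \<xi> y) *v u1 y
                + (\<Sum>j\<in>UNIV. material u1 (\<xi> j) y *\<^sub>R D_field L1 A1 j y)) z
            = (\<Sum>i\<in>UNIV. d_other L2 i (A2 z) * pt (b1 i) z)
              - (\<Sum>i\<in>UNIV. d_other L1 i (A1 z) * pt (b2 i) z)
              + (\<Sum>j\<in>UNIV. xi_bracket L1 A1 u1 j z * pt (\<xi> j) z))
       \<and> (\<forall>z\<in>\<Omega>. pt H2 z
            + diverg (\<lambda>y. H2 y *\<^sub>R u2 y + transpose (Pi_field L2 A2 m2 \<xi> y) *v u2 y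
                + (\<Sum>j\<in>UNIV. material u2 (\<xi> j) y *\<^sub>R D_field L2 A2 j y)) z
            = (\<Sum>i\<in>UNIV. d_other L1 i (A1 z) * pt (b2 i) z)
              - (\<Sum>i\<in>UNIV. d_other L2 i (A2 z) * pt (b1 i) z)
              + (\<Sum>j\<in>UNIV. xi_bracket L2 A2 u2 j z * pt (\<xi> j) z))"
proof -
  interpret P1: phase \<Omega> L1 U1 m1 u1 b1 b2 \<xi> A1
    by (rule phase.intro) (fact assms)+
  interpret P2: phase \<Omega> L2 U2 m2 u2 b2 b1 \<xi> A2
    by (rule phase.intro) (fact assms)+
  have sys: "phase_constraints \<Omega> m1 u1 b1" "phase_constraints \<Omega> m2 u2 b2"
      "momentum_equation \<Omega> L1 A1 L2 A2 m1 u1 b1 b2 \<xi>"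
      "momentum_equation \<Omega> L2 A2 L1 A1 m2 u2 b2 b1 \<xi>"
      "xi_equations \<Omega> L1 A1 L2 A2 u1 u2"
    using assms(17) by (simp_all add: generic_system_def Let_def A1_eq A2_eq)
  have e1: "pt H1 z + diverg P1.energy_flux z
      = (\<Sum>i\<in>UNIV. d_other L2 i (A2 z) * pt (b1 i) z) - (\<Sum>i\<in>UNIV. d_other L1 i (A1 z) * pt (b2 i) z)
        + (\<Sum>j\<in>UNIV. xi_bracket L1 A1 u1 j z * pt (\<xi> j) z)" if "z \<in> \<Omega>" for z
    unfolding H1_eq using P1.hamiltonian_equation[OF that sys(1,3)] .
  have e2: "pt H2 z + diverg P2.energy_flux z
      = (\<Sum>i\<in>UNIV. d_other L1 i (A1 z) * pt (b2 i) z) - (\<Sum>i\<in>UNIV. d_other L2 i (A2 z) * pt (b1 i) z)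
        + (\<Sum>j\<in>UNIV. xi_bracket L2 A2 u2 j z * pt (\<xi> j) z)" if "z \<in> \<Omega>" for z
    unfolding H2_eq using P2.hamiltonian_equation[OF that sys(2,4)] .
  have "pt (\<lambda>y. H1 y + H2 y) z + diverg (\<lambda>y. P1.energy_flux y + P2.energy_flux y) z = 0"
    if z: "z \<in> \<Omega>" for z
  proof -
    \<comment> \<open>The two brackets add up to the left side of the equation for
      \<open>\<xi>\<close>, by additivity of the time derivative and the divergence.\<close>
    have bracket: "xi_bracket L1 A1 u1 j z + xi_bracket L2 A2 u2 j z = 0" for j
    proof -
      have "pt (\<lambda>y. M_field L1 A1 j y + M_field L2 A2 j y) z
        + diverg (\<lambda>y. M_field L1 A1 j y *\<^sub>R u1 y + M_field L2 A2 j y *\<^sub>R u2 y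
            + D_field L1 A1 j y + D_field L2 A2 j y) z
        - d_xi L1 j (A1 z) - d_xi L2 j (A2 z) = 0"
        using sys(5) z by (simp add: xi_equations_def)
      then show ?thesis
        using z by (simp add: xi_bracket_def pt_def partial_add diverg_add)
    qed
    have "(\<Sum>j\<in>UNIV. xi_bracket L1 A1 u1 j z * pt (\<xi> j) z)
        + (\<Sum>j\<in>UNIV. xi_bracket L2 A2 u2 j z * pt (\<xi> j) z) = 0"
      by (simp add: sum.distrib[symmetric] distrib_right[symmetric] bracket)
    moreover have "pt (\<lambda>y. H1 y + H2 y) z = pt H1 z + pt H2 z"
      unfolding H1_eq H2_eq pt_def
      by (rule partial_add[OF P1.differentiable_hamiltonian[OF z] P2.differentiable_hamiltonian[OF z]])
    moreover have "diverg (\<lambda>y. P1.energy_flux y + P2.energy_flux y) z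
        = diverg P1.energy_flux z + diverg P2.energy_flux z"
      by (rule diverg_add[OF P1.differentiable_energy_flux[OF z] P2.differentiable_energy_flux[OF z]])
    ultimately show ?thesis
      using e1[OF z] e2[OF z] by linarith
  qed
  moreover have "P1.energy_flux = (\<lambda>y. H1 y *\<^sub>R u1 y + transpose (Pi_field L1 A1 m1 \<xi> y) *v u1 y
      + (\<Sum>j\<in>UNIV. material u1 (\<xi> j) y *\<^sub>R D_field L1 A1 j y))"
    by (rule ext) (simp add: P1.energy_flux_def H1_eq)
  moreover have "P2.energy_flux = (\<lambda>y. H2 y *\<^sub>R u2 y + transpose (Pi_field L2 A2 m2 \<xi> y) *v u2 y
      + (\<Sum>j\<in>UNIV. material u2 (\<xi> j) y *\<^sub>R D_field L2 A2 j y))"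
    by (rule ext) (simp add: P2.energy_flux_def H2_eq)
  \<comment> \<open>Only the grouping of the total flux remains to be matched; removing
    \<open>transpose_matrix_vector\<close> from the simplifier keeps the transposed products as
    stated.\<close>
  ultimately show ?thesis
    using e1 e2 by (simp add: sum.distrib add_ac del: transpose_matrix_vector)
qed

end
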